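(* Let $N\geq 2$ be an integer and let $\theta\in\left(0,\frac{N-1}{N}\right]$. Then there exists a Euclidean complete affine maximal type hypersurface in $\mathbb{R}^{N+1}$ (with parameter $\theta$) which is not an elliptic paraboloid.
   Context: For a domain $\Omega\subset\mathbb{R}^N$ and $\theta>0$, an affine maximal type hypersurface (with parameter $\theta$) is the graph $\mathcal{M}_\Omega=\{(x,z)\in\mathbb{R}^{N+1}: z=u(x),\ x\in\Omega\}$ of a $C^4$, locally uniformly convex function $u:\Omega\to\mathbb{R}$ (i.e. $D^2u$ is positive definite at every point of $\Omega$) satisfying the affine maximal type equation $$\sum_{i,j=1}^N u^{ij}D_{ij}w=0\quad\text{in }\Omega,\qquad w:=[\det D^2u]^{-\theta},$$ where $[u^{ij}]$ is the inverse matrix of the Hessian $D^2u=[u_{ij}]$. Equivalently, $D_{ij}(U^{ij}w)=0$ (summed over $i,j$) with $U^{ij}$ the cofactor matrix of $[u_{ij}]$. A hypersurface in $\mathbb{R}^{N+1}$ is called Euclidean complete if it is complete under the metric induced from the standard metric of $\mathbb{R}^{N+1}$. An elliptic paraboloid is the graph of a quadratic polynomial with positive definite Hessian. *)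

theory Defs
  imports "HOL-Analysis.Analysis"
begin

definition partial_deriv :: "'n::finite \<Rightarrow> (real^'n \<Rightarrow> real) \<Rightarrow> real^'n \<Rightarrow> real"
  where "partial_deriv i f x = deriv (\<lambda>t. f (x + t *\<^sub>R axis i 1)) 0"

(* Meaningful for open \<Omega>. Demanding differentiability at each stage loses no generality, since
   continuous partial derivatives imply it, and it guarantees that the partial derivatives
   exist, so that deriv never takes an arbitrary value. *)
fun C_k_on :: "nat \<Rightarrow> (real^'n::finite \<Rightarrow> real) \<Rightarrow> (real^'n) set \<Rightarrow> bool"
  where
    "C_k_on 0 f \<Omega> \<longleftrightarrow> continuous_on \<Omega> f"
  | "C_k_on (Suc k) f \<Omega> \<longleftrightarrow> f differentiable_on \<Omega> \<and> (\<forall>i. C_k_on k (partial_deriv i f) \<Omega>)"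

definition hessian :: "(real^'n::finite \<Rightarrow> real) \<Rightarrow> real^'n \<Rightarrow> real^'n^'n"
  where "hessian f x = (\<chi> i j. partial_deriv i (partial_deriv j f) x)"

(* Symmetry is not part of this definition; it is only applied to Hessians of C^2 functions. *)
definition pos_def :: "real^'n^'n::finite \<Rightarrow> bool"
  where "pos_def A \<longleftrightarrow> (\<forall>v. v \<noteq> 0 \<longrightarrow> 0 < v \<bullet> (A *v v))"

definition affine_maximal_type_equation ::
    "real \<Rightarrow> (real^'n::finite) set \<Rightarrow> (real^'n \<Rightarrow> real) \<Rightarrow> bool"
  where "affine_maximal_type_equation \<theta> \<Omega> u \<longleftrightarrow>
    (let w = (\<lambda>x. det (hessian u x) powr (- \<theta>)) in
      \<forall>x\<in>\<Omega>. (\<Sum>i\<in>UNIV. \<Sum>j\<in>UNIV.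
        matrix_inv (hessian u x) $ i $ j * partial_deriv i (partial_deriv j w) x) = 0)"

(* The ambient space R^(N+1) is the product (real^'n) \<times> real, whose norm is the Euclidean one. *)
definition graph_on :: "(real^'n::finite) set \<Rightarrow> (real^'n \<Rightarrow> real) \<Rightarrow> ((real^'n) \<times> real) set"
  where "graph_on \<Omega> u = {(x, z). x \<in> \<Omega> \<and> z = u x}"

definition affine_maximal_type_hypersurface :: "real \<Rightarrow> ((real^'n::finite) \<times> real) set \<Rightarrow> bool"
  where "affine_maximal_type_hypersurface \<theta> M \<longleftrightarrow>
    (\<exists>\<Omega> u. open \<Omega> \<and> connected \<Omega> \<and> \<Omega> \<noteq> {} \<and> C_k_on 4 u \<Omega> \<and>
      (\<forall>x\<in>\<Omega>. pos_def (hessian u x)) \<and>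
      affine_maximal_type_equation \<theta> \<Omega> u \<and>
      M = graph_on \<Omega> u)"

(* Riemannian distance on a submanifold M for the metric induced from the ambient space: infimum
   of the lengths of piecewise C^1 curves inside M. A valid_path may have unbounded speed near
   its finitely many exceptional points, so its length need not be finite; has_integral discards
   such curves, where the integral operator would silently give them length 0. *)
definition induced_dist :: "'a::euclidean_space set \<Rightarrow> 'a \<Rightarrow> 'a \<Rightarrow> real"
  where "induced_dist M p q =
    Inf {L. \<exists>\<gamma>. valid_path \<gamma> \<and> path_image \<gamma> \<subseteq> M \<and> pathstart \<gamma> = p \<and> pathfinish \<gamma> = q \<and>
      ((\<lambda>t. norm (vector_derivative \<gamma> (at t))) has_integral L) {0..1}}"

(* Metric completeness of M under induced_dist. It is written out because mcomplete comes with
   the locale Metric_space, whose facts presuppose the metric axioms. *)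
definition Euclidean_complete :: "'a::euclidean_space set \<Rightarrow> bool"
  where "Euclidean_complete M \<longleftrightarrow>
    (\<forall>\<sigma>::nat \<Rightarrow> 'a. range \<sigma> \<subseteq> M \<and>
        (\<forall>\<epsilon>>0. \<exists>K. \<forall>m\<ge>K. \<forall>n\<ge>K. induced_dist M (\<sigma> m) (\<sigma> n) < \<epsilon>) \<longrightarrow>
      (\<exists>p\<in>M. (\<lambda>n. induced_dist M (\<sigma> n) p) \<longlonglongrightarrow> 0))"

definition elliptic_paraboloid :: "((real^'n::finite) \<times> real) set \<Rightarrow> bool"
  where "elliptic_paraboloid M \<longleftrightarrow>
    (\<exists>A b c. let q = (\<lambda>x. x \<bullet> (A *v x) + b \<bullet> x + c) in
      (\<forall>x. pos_def (hessian q x)) \<and> M = graph_on UNIV q)"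

end

theory Submission
  imports Defs
begin

text \<open>Look for an entire solution \<open>u = G \<circ> \<phi>\<close> with \<open>\<phi> x = (\<Sum>i\<noteq>e. x\<^sub>i\<^sup>2) / 2 - x\<^sub>e\<close>.
  If \<open>P = G'\<close>, then \<open>det D\<^sup>2u = P\<^bsup>N-1\<^esup> P'\<close>, and for a function \<open>w = F \<circ> \<phi>\<close> the operator
  becomes \<open>F'' / P' + (N - 1) F' / P\<close>, so the equation says that \<open>F' P\<^bsup>N-1\<^esup>\<close> is constant.
  With \<open>\<gamma> = 1 / (1 - \<theta>)\<close> it is solved by every solution of
  \<open>P' = (P - 1)\<^bsup>\<gamma>\<^esup> P\<^bsup>1-N\<^esup>\<close>, \<open>P > 1\<close>, for which \<open>det D\<^sup>2u = (P - 1)\<^bsup>\<gamma>\<^esup>\<close>.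
  Writing \<open>P = 1 + exp Q\<close>, this is \<open>Q' = exp ((\<gamma> - 1) Q) (1 + exp Q)\<^bsup>1-N\<^esup>\<close>, whose
  right-hand side lies in \<open>(0, 1]\<close> precisely because \<open>1 \<le> \<gamma> \<le> N\<close>, that is
  \<open>0 \<le> \<theta> \<le> (N - 1) / N\<close>; hence \<open>Q\<close> exists on the whole line. The graph of \<open>u\<close> is
  entire, hence complete, and \<open>u\<close> is not quadratic since \<open>G' > 1\<close> is not constant.\<close>

section \<open>Partial derivatives from the total derivative\<close>

lemma partial_deriv_eqI:
  assumes "(f has_derivative f') (at x)"
  shows "partial_deriv i f x = f' (axis i 1)"
proof -
  interpret bounded_linear f' using assms by (rule has_derivative_bounded_linear)
  have "((\<lambda>t. x + t *\<^sub>R axis i 1) has_derivative (\<lambda>t. t *\<^sub>R axis i 1)) (at (0::real))"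
    by (auto intro!: derivative_eq_intros)
  then have "((\<lambda>t. f (x + t *\<^sub>R axis i 1)) has_derivative (\<lambda>t. f' (t *\<^sub>R axis i 1))) (at 0)"
    by (rule has_derivative_compose) (use assms in simp)
  then have "((\<lambda>t. f (x + t *\<^sub>R axis i 1)) has_real_derivative f' (axis i 1)) (at 0)"
    by (rule has_derivative_imp_has_field_derivative) (simp add: scaleR)
  then show ?thesis
    unfolding partial_deriv_def by (rule DERIV_imp_deriv)
qed

section \<open>Linear algebra of diagonal plus rank-one matrices\<close>

lemma det_identity_replace_row:
  fixes a :: "'a::field^'n"
  shows "det (\<chi> i. if i = k then a else axis i 1) = a $ k"
proof -
  have rows: "row i (mat 1 :: 'a^'n^'n) = axis i 1" for i
    by (vector row_def mat_def axis_def)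
  from cramer_lemma_transpose[of k a "mat 1"] show ?thesis
    unfolding rows basis_expansion by simp
qed

text \<open>The shape of the Hessian of a composition \<open>F \<circ> \<phi>\<close>, with
  \<open>a\<close> the gradient of \<phi>, \<open>p = F'\<close> and \<open>s = F''\<close>. The
  Hessian of \<phi> itself is the identity with its entry at \<open>e\<close> erased, as \<phi> is
  affine in that coordinate.\<close>

definition bordered_matrix :: "'n::finite \<Rightarrow> real^'n \<Rightarrow> real \<Rightarrow> real \<Rightarrow> real^'n^'n"
  where "bordered_matrix e a p s =
    (\<chi> i j. (if i = j \<and> i \<noteq> e then p else 0) + s * a $ i * a $ j)"

text \<open>The associated quadratic form is \<open>p\<close> times the sum of the squares of the
  coordinates other than \<open>e\<close>, plus \<open>s\<close> times the square of
  \<open>a \<bullet> v\<close>. Taking \<open>a \<bullet> v\<close> as the new coordinate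
  \<open>e\<close> therefore diagonalises it. That change of coordinates is \<open>L e a\<close>,
  whose determinant is \<open>a $ e\<close>.\<close>

lemma bordered_matrix_factor:
  defines "L \<equiv> \<lambda>e a. (\<chi> i. if i = e then a else axis i 1)"
  shows "bordered_matrix e a p s =
    transpose (L e a) ** (\<chi> i j. if i = j then (if i = e then s else p) else 0) ** L e a"
proof -
  have "(transpose (L e a) ** (\<chi> i j. if i = j then (if i = e then s else p) else 0) ** L e a) $ i $ j
      = bordered_matrix e a p s $ i $ j" for i j
  proof -
    have "(transpose (L e a) ** (\<chi> i j. if i = j then (if i = e then s else p) else 0) ** L e a) $ i $ j
      = (\<Sum>k\<in>UNIV. L e a $ k $ i * (if k = e then s else p) * L e a $ k $ j)"
    proof -
      have "((\<chi> i j. if i = j then (if i = e then s else p) else 0) ** L e a) $ k $ j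
          = (if k = e then s else p) * L e a $ k $ j" for k
      proof -
        have "((\<chi> i j. if i = j then (if i = e then s else p) else 0) ** L e a) $ k $ j
          = (\<Sum>l\<in>UNIV. if l = k then (if k = e then s else p) * L e a $ k $ j else 0)"
          unfolding matrix_matrix_mult_def vec_lambda_beta by (intro sum.cong) auto
        then show ?thesis by simp
      qed
      moreover have "(transpose (L e a) ** B) $ i $ j = (\<Sum>k\<in>UNIV. L e a $ k $ i * B $ k $ j)"
        for B :: "real^'a^'a"
        by (simp add: matrix_matrix_mult_def transpose_def)
      ultimately show ?thesis
        by (simp only: matrix_mul_assoc[symmetric] mult.assoc)
    qed
    also have "\<dots> = (\<Sum>k\<in>UNIV. (if k = e then s * a $ i * a $ j else 0) +
        (if k = i then (if i = j \<and> i \<noteq> e then p else 0) else 0))"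
      by (rule sum.cong) (auto simp: L_def axis_def)
    also have "\<dots> = bordered_matrix e a p s $ i $ j"
      by (simp add: sum.distrib bordered_matrix_def)
    finally show ?thesis .
  qed
  then show ?thesis
    by (simp add: vec_eq_iff)
qed

lemma det_bordered_matrix:
  "det (bordered_matrix e (a::real^'n::finite) p s) = (a $ e)\<^sup>2 * p ^ (CARD('n) - 1) * s"
proof -
  have "det (\<chi> i j. if i = j then (if i = e then s else p) else 0 :: real^'n^'n)
      = (\<Prod>i\<in>UNIV. if i = e then s else p)"
    by (subst det_diagonal) auto
  also have "\<dots> = s * (\<Prod>i\<in>UNIV - {e}. p)"
    by (subst prod.remove[of _ e]) auto
  finally have D: "det (\<chi> i j. if i = j then (if i = e then s else p) else 0 :: real^'n^'n)
      = s * p ^ (CARD('n) - 1)"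
    by (simp add: card_Diff_singleton)
  show ?thesis
    unfolding bordered_matrix_factor det_mul det_transpose det_identity_replace_row D
    by (simp add: power2_eq_square)
qed

text \<open>Both parts of the quadratic form are nonnegative. The first vanishes only for
  \<open>v\<close> on the \<open>e\<close>-axis, and there
  \<open>a \<bullet> v = a $ e * v $ e\<close> is nonzero unless \<open>v = 0\<close>.\<close>

lemma pos_def_bordered_matrix:
  fixes a :: "real^'n::finite"
  assumes "a $ e \<noteq> 0" "p > 0" "s > 0"
  shows "pos_def (bordered_matrix e a p s)"
  unfolding pos_def_def
proof (intro allI impI)
  fix v :: "real^'n" assume v: "v \<noteq> 0"
  have "(bordered_matrix e a p s *v v) $ i = (if i = e then 0 else p * v $ i) + s * a $ i * (a \<bullet> v)" for i
  proof -
    have "(bordered_matrix e a p s *v v) $ i =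
      (\<Sum>j\<in>UNIV. (if j = i then (if i = e then 0 else p * v $ i) else 0) + s * a $ i * (a $ j * v $ j))"
      unfolding bordered_matrix_def matrix_vector_mult_def
      by (auto simp: algebra_simps intro!: sum.cong)
    also have "\<dots> = (if i = e then 0 else p * v $ i) + s * a $ i * (a \<bullet> v)"
      by (simp only: sum.distrib sum_distrib_left[symmetric] inner_vec_def inner_real_def) simp
    finally show ?thesis .
  qed
  then have "v \<bullet> (bordered_matrix e a p s *v v)
    = (\<Sum>i\<in>UNIV. (if i = e then 0 else p * (v $ i)\<^sup>2) + s * (a \<bullet> v) * (a $ i * v $ i))"
    unfolding inner_vec_def[of v] by (auto simp: algebra_simps power2_eq_square intro!: sum.cong)
  also have "\<dots> = (\<Sum>i\<in>UNIV. if i = e then 0 else p * (v $ i)\<^sup>2) + s * (a \<bullet> v)\<^sup>2"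
    by (simp only: sum.distrib sum_distrib_left[symmetric] power2_eq_square)
       (simp add: inner_vec_def)
  finally have eq: "v \<bullet> (bordered_matrix e a p s *v v)
    = (\<Sum>i\<in>UNIV. if i = e then 0 else p * (v $ i)\<^sup>2) + s * (a \<bullet> v)\<^sup>2" .
  have nn: "(\<Sum>i\<in>UNIV. if i = e then 0 else p * (v $ i)\<^sup>2) \<ge> 0"
    using assms by (intro sum_nonneg) auto
  show "0 < v \<bullet> (bordered_matrix e a p s *v v)"
  proof (cases "\<exists>k. k \<noteq> e \<and> v $ k \<noteq> 0")
    case True
    then obtain k where k: "k \<noteq> e" "v $ k \<noteq> 0" by blast
    have "0 < (\<Sum>i\<in>UNIV. if i = e then 0 else p * (v $ i)\<^sup>2)"
      using assms k by (intro sum_pos2[of _ k]) auto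
    with assms show ?thesis
      unfolding eq by (intro add_pos_nonneg) auto
  next
    case False
    then have "a \<bullet> v = (\<Sum>i\<in>UNIV. if i = e then a $ e * v $ e else 0)"
      unfolding inner_vec_def inner_real_def by (intro sum.cong) auto
    moreover have "v $ e \<noteq> 0"
      using v False by (metis vec_eq_iff zero_index)
    ultimately have "a \<bullet> v \<noteq> 0"
      using assms by simp
    with nn assms show ?thesis
      unfolding eq by (intro add_nonneg_pos) auto
  qed
qed

lemma matrix_inv_left:
  assumes "invertible (A :: 'a::semiring_1^'n^'m)"
  shows "matrix_inv A ** A = mat 1"
  using someI_ex[OF assms[unfolded invertible_def]] unfolding matrix_inv_def by blast

text \<open>If \<open>H\<close> and \<open>W\<close> are the two bordered matrices, then \<open>W = H ** M\<close>, where
  \<open>M\<close> is a multiple of the identity plus a rank-one matrix.\<close>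

lemma sum_inverse_bordered_matrix:
  fixes a :: "real^'n::finite"
  assumes "a $ e = -1" "p > 0" "s > 0"
  shows "(\<Sum>i\<in>UNIV. \<Sum>j\<in>UNIV.
      matrix_inv (bordered_matrix e a p s) $ i $ j * bordered_matrix e a p' s' $ i $ j)
    = (real CARD('n) - 1) * (p' / p) + s' / s"
proof -
  \<comment> \<open>Column \<open>e\<close> of \<open>H\<close> is \<open>- s\<close> times
    \<open>a\<close>, because \<open>a $ e = -1\<close>. Hence \<open>H ** M\<close> is \<nu> times
    \<open>H\<close> plus \<open>\<mu> * s\<close> times the outer square of \<open>a\<close>, and
    these values of \<nu> and \<mu> turn the coefficients into \<open>p'\<close> and
    \<open>s'\<close>.\<close>
  define \<nu> \<mu> where "\<nu> = p' / p" and "\<mu> = s' / s - p' / p"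
  define H W M where "H = bordered_matrix e a p s" and "W = bordered_matrix e a p' s'"
    and "M = (\<chi> i j. (if i = j then \<nu> else 0) - (if i = e then \<mu> * a $ j else 0))"
  have "(H ** M) $ i $ j = W $ i $ j" for i j
  proof -
    have "(H ** M) $ i $ j = (\<Sum>k\<in>UNIV. (if k = j then \<nu> * H $ i $ j else 0)
        - (if k = e then H $ i $ e * \<mu> * a $ j else 0))"
      unfolding matrix_matrix_mult_def by (auto simp: M_def algebra_simps intro!: sum.cong)
    also have "\<dots> = \<nu> * H $ i $ j - H $ i $ e * \<mu> * a $ j"
      by (simp add: sum_subtractf)
    also have "\<dots> = W $ i $ j"
      using assms by (auto simp: H_def W_def bordered_matrix_def \<nu>_def \<mu>_def field_simps)
    finally show ?thesis .
  qed
  then have HM: "H ** M = W"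
    by (simp add: vec_eq_iff)
  have "invertible H"
    using assms by (simp add: invertible_det_nz H_def det_bordered_matrix)
  then have "matrix_inv H ** W = M"
    by (simp add: HM[symmetric] matrix_mul_assoc matrix_inv_left)
  \<comment> \<open>Since \<open>W\<close> is symmetric, the double sum to be computed is the trace
    of \<open>matrix_inv H ** W\<close>, which is the trace of \<open>M\<close>.\<close>
  then have "(\<Sum>i\<in>UNIV. (matrix_inv H ** W) $ i $ i) = (\<Sum>i\<in>UNIV. M $ i $ i)"
    by simp
  also have "(\<Sum>i\<in>UNIV. (matrix_inv H ** W) $ i $ i) =
      (\<Sum>i\<in>UNIV. \<Sum>j\<in>UNIV. matrix_inv H $ i $ j * W $ i $ j)"
  proof -
    have "W $ j $ i = W $ i $ j" for i j
      by (auto simp: W_def bordered_matrix_def)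
    then show ?thesis
      by (simp add: matrix_matrix_mult_def)
  qed
  also have "(\<Sum>i\<in>UNIV. M $ i $ i) = (real CARD('n) - 1) * (p' / p) + s' / s"
  proof -
    have "M $ i $ i = \<nu> - (if i = e then \<mu> * a $ e else 0)" for i
      by (simp add: M_def)
    then have "(\<Sum>i\<in>UNIV. M $ i $ i) = real CARD('n) * \<nu> - \<mu> * a $ e"
      by (simp add: sum_subtractf)
    then show ?thesis
      using assms by (simp add: \<nu>_def \<mu>_def algebra_simps)
  qed
  finally show ?thesis
    by (simp add: H_def W_def)
qed

section \<open>Completeness of entire graphs\<close>

text \<open>The chord is the integral of the velocity, where the fundamental theorem tolerates
  finitely many exceptional points, and its norm is at most the integral of the speed.\<close>

lemma induced_length_ge_dist:
  fixes \<gamma> :: "real \<Rightarrow> 'a::euclidean_space"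
  assumes "valid_path \<gamma>" "((\<lambda>t. norm (vector_derivative \<gamma> (at t))) has_integral L) {0..1}"
  shows "dist (pathstart \<gamma>) (pathfinish \<gamma>) \<le> L"
proof -
  obtain S where S: "finite S" "\<gamma> C1_differentiable_on {0..1} - S" and cont: "continuous_on {0..1} \<gamma>"
    using assms(1) unfolding valid_path_def piecewise_C1_differentiable_on_def by auto
  have "((\<lambda>t. vector_derivative \<gamma> (at t)) has_integral (\<gamma> 1 - \<gamma> 0)) {0..1}"
  proof (rule fundamental_theorem_of_calculus_strong[OF S(1)])
    show "(\<gamma> has_vector_derivative vector_derivative \<gamma> (at t)) (at t)" if "t \<in> {0..1} - S" for t
      using S(2) that unfolding C1_differentiable_on_eq vector_derivative_works by blast
  qed (use cont in auto)
  then have "norm (\<gamma> 1 - \<gamma> 0) \<le> L"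
    using assms(2) integral_norm_bound_integral[of "\<lambda>t. vector_derivative \<gamma> (at t)" "{0..1}"
        "\<lambda>t. norm (vector_derivative \<gamma> (at t))"]
    by (auto simp: has_integral_iff)
  then show ?thesis
    by (simp add: pathstart_def pathfinish_def dist_norm norm_minus_commute)
qed

text \<open>The segment from \<open>x\<close> to \<open>y\<close> is lifted to the graph. Its speed
  is at most \<open>norm (y - x)\<close> from the base plus \<open>B * norm (y - x)\<close> from the
  height.\<close>

lemma entire_graph_segment_path:
  fixes u :: "real^'n::finite \<Rightarrow> real"
  assumes der: "\<And>x. (u has_derivative (\<lambda>h. g x \<bullet> h)) (at x)" and cont: "continuous_on UNIV g"
    and bound: "\<And>z. z \<in> closed_segment x y \<Longrightarrow> norm (g z) \<le> B"
  shows "\<exists>L\<le>(1 + B) * norm (y - x). \<exists>\<gamma>. valid_path \<gamma> \<and> path_image \<gamma> \<subseteq> graph_on UNIV u \<and>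
    pathstart \<gamma> = (x, u x) \<and> pathfinish \<gamma> = (y, u y) \<and>
    ((\<lambda>t. norm (vector_derivative \<gamma> (at t))) has_integral L) {0..1}"
proof -
  define z where "z t = x + t *\<^sub>R (y - x)" for t
  define \<gamma> where "\<gamma> t = (z t, u (z t))" for t
  define \<gamma>' where "\<gamma>' t = (y - x, g (z t) \<bullet> (y - x))" for t
  have z': "(z has_vector_derivative (y - x)) (at t)" for t
    unfolding z_def has_vector_derivative_def by (auto intro!: derivative_eq_intros)
  have \<gamma>': "(\<gamma> has_vector_derivative \<gamma>' t) (at t)" for t
  proof -
    have "((\<lambda>t. u (z t)) has_derivative (\<lambda>h. g (z t) \<bullet> (h *\<^sub>R (y - x)))) (at t)"
      by (rule has_derivative_compose[OF z'[unfolded has_vector_derivative_def] der])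
    then have "((\<lambda>t. u (z t)) has_vector_derivative (g (z t) \<bullet> (y - x))) (at t)"
      by (simp add: has_vector_derivative_def)
    with z' show ?thesis
      unfolding \<gamma>_def \<gamma>'_def by (rule has_vector_derivative_Pair)
  qed
  have contz: "continuous_on A z" for A
    unfolding z_def by (intro continuous_intros)
  have cont': "continuous_on A \<gamma>'" for A
    unfolding \<gamma>'_def
    by (intro continuous_intros continuous_on_compose2[OF cont contz]) auto
  have vd: "vector_derivative \<gamma> (at t) = \<gamma>' t" for t
    using \<gamma>' by (rule vector_derivative_at)
  have "\<gamma> C1_differentiable_on {0..1}"
    unfolding C1_differentiable_on_def using \<gamma>' cont' by blast
  then have "valid_path \<gamma>"
    unfolding valid_path_def by (rule C1_differentiable_imp_piecewise)
  moreover have "path_image \<gamma> \<subseteq> graph_on UNIV u"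
    by (auto simp: path_image_def \<gamma>_def graph_on_def)
  moreover have "pathstart \<gamma> = (x, u x)" "pathfinish \<gamma> = (y, u y)"
    by (auto simp: pathstart_def pathfinish_def \<gamma>_def z_def)
  moreover have int: "((\<lambda>t. norm (\<gamma>' t)) has_integral integral {0..1} (\<lambda>t. norm (\<gamma>' t))) {0..1}"
    by (intro integrable_integral integrable_continuous_interval continuous_intros cont')
  moreover have "integral {0..1} (\<lambda>t. norm (\<gamma>' t)) \<le> (1 + B) * norm (y - x)"
  proof -
    have "norm (\<gamma>' t) \<le> (1 + B) * norm (y - x)" if "t \<in> {0..1}" for t
    proof -
      have "z t \<in> closed_segment x y"
        using that unfolding closed_segment_def z_def
        by (auto simp: algebra_simps intro!: exI[of _ t])
      then have "\<bar>g (z t) \<bullet> (y - x)\<bar> \<le> B * norm (y - x)"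
        using bound Cauchy_Schwarz_ineq2[of "g (z t)" "y - x"]
        by (meson mult_right_mono norm_ge_zero order_trans)
      moreover have "norm (\<gamma>' t) \<le> norm (y - x) + norm (g (z t) \<bullet> (y - x))"
        unfolding \<gamma>'_def by (rule norm_Pair_le)
      ultimately show ?thesis
        by (simp add: algebra_simps)
    qed
    then have "integral {0..1} (\<lambda>t. norm (\<gamma>' t)) \<le> integral {0..1::real} (\<lambda>t. (1 + B) * norm (y - x))"
      using int by (intro integral_le) (auto simp: integrable_on_def)
    then show ?thesis
      by simp
  qed
  ultimately show ?thesis
    by (intro exI[of _ "integral {0..1} (\<lambda>t. norm (\<gamma>' t))"] exI[of _ \<gamma>] conjI)
      (simp_all add: vd)
qed

text \<open>The induced distance dominates the ambient one, so the base points of a Cauchy sequence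
  converge to some \<open>l\<close>, over which the graph has a point since it is entire. Near
  \<open>l\<close> the gradient is bounded, so lifted segments show convergence in the induced
  distance as well.\<close>

lemma Euclidean_complete_entire_graph:
  fixes u :: "real^'n::finite \<Rightarrow> real"
  assumes der: "\<And>x. (u has_derivative (\<lambda>h. g x \<bullet> h)) (at x)" and cont: "continuous_on UNIV g"
  shows "Euclidean_complete (graph_on UNIV u)"
  unfolding Euclidean_complete_def
proof (intro allI impI, elim conjE)
  fix \<sigma> :: "nat \<Rightarrow> (real^'n) \<times> real"
  assume ran: "range \<sigma> \<subseteq> graph_on UNIV u"
    and Cau: "\<forall>\<epsilon>>0. \<exists>K. \<forall>m\<ge>K. \<forall>n\<ge>K. induced_dist (graph_on UNIV u) (\<sigma> m) (\<sigma> n) < \<epsilon>"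
  define \<xi> where "\<xi> n = fst (\<sigma> n)" for n
  have \<sigma>: "\<sigma> n = (\<xi> n, u (\<xi> n))" for n
  proof -
    have "\<sigma> n \<in> graph_on UNIV u" using ran by auto
    then show ?thesis by (auto simp: \<xi>_def graph_on_def split: prod.splits)
  qed
  define lens where "lens p q = {L. \<exists>\<gamma>. valid_path \<gamma> \<and> path_image \<gamma> \<subseteq> graph_on UNIV u \<and>
      pathstart \<gamma> = p \<and> pathfinish \<gamma> = q \<and>
      ((\<lambda>t. norm (vector_derivative \<gamma> (at t))) has_integral L) {0..1}}" for p q
  have ge: "dist p q \<le> L" if "L \<in> lens p q" for p q L
    using that induced_length_ge_dist unfolding lens_def by blast
  have bdd: "bdd_below (lens p q)" for p q
    using ge by (rule bdd_belowI)
  have le: "induced_dist (graph_on UNIV u) (x, u x) (y, u y) \<le> (1 + B) * norm (y - x)"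
    if B: "\<And>z. z \<in> closed_segment x y \<Longrightarrow> norm (g z) \<le> B" for x y B
  proof -
    obtain L where "L \<in> lens (x, u x) (y, u y)" "L \<le> (1 + B) * norm (y - x)"
      using entire_graph_segment_path[OF der cont B] unfolding lens_def by blast
    then show ?thesis
      using cInf_lower[OF _ bdd] unfolding induced_dist_def lens_def[symmetric] by force
  qed
  have dist_le: "dist (x, u x) (y, u y) \<le> induced_dist (graph_on UNIV u) (x, u x) (y, u y)" for x y
  proof -
    \<comment> \<open>A lower bound for \<open>Inf\<close> requires a nonempty set of lengths.
      Boundedness of the gradient on the compact segment supplies a lifted segment of finite
      length.\<close>
    have "compact (g ` closed_segment x y)"
      using cont by (intro compact_continuous_image) (auto intro: continuous_on_subset)
    then obtain B where "\<And>z. z \<in> closed_segment x y \<Longrightarrow> norm (g z) \<le> B"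
      using compact_imp_bounded bounded_iff by (metis image_eqI)
    then have "lens (x, u x) (y, u y) \<noteq> {}"
      using entire_graph_segment_path[OF der cont] unfolding lens_def by blast
    then show ?thesis
      using ge unfolding induced_dist_def lens_def[symmetric] by (intro cInf_greatest)
  qed
  have "Cauchy \<xi>"
  proof (rule metric_CauchyI)
    fix \<epsilon> :: real assume "\<epsilon> > 0"
    then obtain K where "\<And>m n. m \<ge> K \<Longrightarrow> n \<ge> K \<Longrightarrow>
        induced_dist (graph_on UNIV u) (\<sigma> m) (\<sigma> n) < \<epsilon>"
      using Cau by blast
    moreover have "dist (\<xi> m) (\<xi> n) \<le> dist (\<sigma> m) (\<sigma> n)" for m n
      unfolding \<xi>_def by (rule dist_fst_le)
    ultimately show "\<exists>K. \<forall>m\<ge>K. \<forall>n\<ge>K. dist (\<xi> m) (\<xi> n) < \<epsilon>"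
      using dist_le unfolding \<sigma> by (meson le_less_trans order_trans)
  qed
  then obtain l where l: "\<xi> \<longlonglongrightarrow> l"
    using Cauchy_convergent_iff convergent_def by blast
  have "compact (g ` cball l 1)"
    using cont by (intro compact_continuous_image) (auto intro: continuous_on_subset)
  then obtain B where B: "\<And>z. z \<in> cball l 1 \<Longrightarrow> norm (g z) \<le> B"
    using compact_imp_bounded bounded_iff by (metis image_eqI)
  have "(\<lambda>n. induced_dist (graph_on UNIV u) (\<sigma> n) (l, u l)) \<longlonglongrightarrow> 0"
  proof (rule tendsto_sandwich)
    show "(\<lambda>n. 0) \<longlonglongrightarrow> (0::real)" by simp
    show "\<forall>\<^sub>F n in sequentially. 0 \<le> induced_dist (graph_on UNIV u) (\<sigma> n) (l, u l)"
      using dist_le unfolding \<sigma> by (intro always_eventually allI) (meson order_trans zero_le_dist)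
    have "\<forall>\<^sub>F n in sequentially. dist (\<xi> n) l < 1"
      using l by (rule tendstoD) simp
    then show "\<forall>\<^sub>F n in sequentially.
        induced_dist (graph_on UNIV u) (\<sigma> n) (l, u l) \<le> (1 + B) * norm (l - \<xi> n)"
    proof eventually_elim
      case (elim n)
      then have "closed_segment (\<xi> n) l \<subseteq> cball l 1"
        by (intro closed_segment_subset) (auto simp: dist_commute)
      then show ?case
        unfolding \<sigma> using B by (intro le) blast
    qed
    have "(\<lambda>n. (1 + B) * norm (l - \<xi> n)) \<longlonglongrightarrow> (1 + B) * norm (l - l)"
      by (intro tendsto_intros l)
    then show "(\<lambda>n. (1 + B) * norm (l - \<xi> n)) \<longlonglongrightarrow> 0" by simp
  qed
  then show "\<exists>p\<in>graph_on UNIV u. (\<lambda>n. induced_dist (graph_on UNIV u) (\<sigma> n) p) \<longlonglongrightarrow> 0"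
    by (intro bexI[of _ "(l, u l)"]) (auto simp: graph_on_def)
qed

section \<open>Global solution of the profile equation\<close>

lemma ex_antiderivative:
  fixes f :: "real \<Rightarrow> real"
  assumes "\<And>x. isCont f x"
  shows "\<exists>F. \<forall>x. (F has_real_derivative f x) (at x)"
  using einterval_antiderivative[of "-\<infinity>" \<infinity> f] assms
  by (auto simp: has_real_derivative_iff_has_vector_derivative)

text \<open>Separation of variables: \<open>Q\<close> is the inverse of an antiderivative
  \<open>F\<close> of \<open>h\<close>. As \<open>h \<ge> 1\<close>, \<open>F\<close> expands
  distances, so it maps onto the whole line and its inverse is 1-Lipschitz; no solution can blow
  up.\<close>

lemma ex_inverse_of_expanding:
  fixes h :: "real \<Rightarrow> real"
  assumes cont: "\<And>x. isCont h x" and ge1: "\<And>x. h x \<ge> 1"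
  shows "\<exists>Q. \<forall>s. (Q has_real_derivative inverse (h (Q s))) (at s)"
proof -
  obtain F where F: "\<And>x. (F has_real_derivative h x) (at x)"
    using ex_antiderivative[OF cont] by blast
  have grow: "F y - F x \<ge> y - x" if xy: "x \<le> y" for x y
  proof (cases "x = y")
    case False
    then obtain z where "F y - F x = (y - x) * h z"
      using MVT2[of x y F h] F xy by auto
    also have "\<dots> \<ge> (y - x) * 1"
      using xy ge1 by (intro mult_left_mono) auto
    finally show ?thesis by simp
  qed auto
  have "\<exists>x. F x = s" for s
  proof -
    \<comment> \<open>Expansion gives \<open>F (-r) \<le> F 0 - r\<close> and
      \<open>F 0 + r \<le> F r\<close>, so this radius encloses the value \<open>s\<close>.\<close>
    define r where "r = \<bar>s - F 0\<bar>"
    have "F (-r) \<le> s" "s \<le> F r"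
      using grow[of "-r" 0] grow[of 0 r] by (auto simp: r_def)
    moreover have "\<forall>x. isCont F x"
      using F DERIV_isCont by blast
    ultimately show ?thesis
      using IVT[of F "-r" s r] by (auto simp: r_def)
  qed
  then obtain Q where Q: "\<And>s. F (Q s) = s"
    by metis
  have lip: "\<bar>Q s - Q t\<bar> \<le> \<bar>s - t\<bar>" for s t
    using grow[of "Q s" "Q t"] grow[of "Q t" "Q s"] unfolding Q by linarith
  have "isCont Q s" for s
  proof -
    have "((\<lambda>t. \<bar>t - s\<bar>) \<longlongrightarrow> \<bar>s - s\<bar>) (at s)"
      by (intro tendsto_intros)
    then have "((\<lambda>t. Q t - Q s) \<longlongrightarrow> 0) (at s)"
      by (intro Lim_null_comparison[of "\<lambda>t. Q t - Q s" "\<lambda>t. \<bar>t - s\<bar>"]) (auto intro!: always_eventually lip)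
    then show ?thesis
      by (simp add: isCont_def Lim_null[symmetric])
  qed
  moreover have "h x \<noteq> 0" for x
    using ge1[of x] by linarith
  ultimately have "(Q has_real_derivative inverse (h (Q s))) (at s)" for s
    using Q F by (intro DERIV_inverse_function[of F _ _ _ "s - 1" "s + 1"]) auto
  then show ?thesis by blast
qed

text \<open>All functions of the profile variable that occur below are combinations of these terms, a
  family closed under products and, along \<open>Q\<close>, under differentiation.\<close>

definition profile_term :: "real \<Rightarrow> real \<Rightarrow> real \<Rightarrow> real"
  where "profile_term c d q = exp (c * q) * (1 + exp q) powr d"

lemma profile_term_pos: "profile_term c d q > 0"
proof -
  have "1 + exp q > 0" by (intro add_pos_pos) auto
  then show ?thesis by (simp add: profile_term_def)
qed

lemma profile_term_mult:
  "profile_term c d q * profile_term c' d' q = profile_term (c + c') (d + d') q"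
  by (simp add: profile_term_def powr_add exp_add algebra_simps)

lemma profile_term_inverse: "inverse (profile_term c d q) = profile_term (- c) (- d) q"
  by (simp add: profile_term_def powr_minus exp_minus)

lemma profile_term_power: "profile_term c d q ^ n = profile_term (n * c) (n * d) q"
proof (induction n)
  case (Suc n)
  have "1 + exp q \<noteq> 0"
    using add_pos_pos[of 1 "exp q"] by auto
  with Suc show ?case by (simp add: profile_term_mult algebra_simps)
next
  case 0
  show ?case
    using add_pos_pos[of 1 "exp q"] by (auto simp: profile_term_def)
qed

lemma profile_term_DERIV:
  "(profile_term c d has_real_derivative c * profile_term c d q + d * profile_term (c + 1) (d - 1) q) (at q)"
proof -
  have "1 + exp q > 0" by (intro add_pos_pos) auto
  then show ?thesis
    unfolding profile_term_def
    by (auto intro!: derivative_eq_intros simp: powr_diff exp_add field_simps)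
qed

text \<open>For \<open>q \<le> 0\<close> both factors are at least 1; for \<open>q > 0\<close> the
  estimate \<open>1 + exp q \<ge> exp q\<close> leaves \<open>exp ((d - c) * q)\<close>. With
  \<open>c = \<gamma> - 1\<close> and \<open>d = n - 1\<close> the hypotheses become
  \<open>1 \<le> \<gamma> \<le> n\<close>, and the term is the reciprocal of the right-hand side of
  the equation for \<open>Q\<close>.\<close>

lemma profile_term_ge_1:
  assumes "0 \<le> c" "c \<le> d"
  shows "profile_term (- c) d q \<ge> 1"
proof (cases "q \<le> 0")
  case True
  have "(1 + exp q) powr d \<ge> 1" "exp (- c * q) \<ge> 1"
    using assms True by (auto simp: ge_one_powr_ge_zero mult_nonneg_nonpos)
  then show ?thesis
    unfolding profile_term_def using mult_mono[of 1 "exp (- c * q)" 1 "(1 + exp q) powr d"] by simp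
next
  case False
  have "1 \<le> exp ((d - c) * q)"
    using assms False by simp
  also have "\<dots> = exp (- c * q) * exp q powr d"
    by (simp add: powr_def exp_add[symmetric] algebra_simps)
  also have "\<dots> \<le> profile_term (- c) d q"
    unfolding profile_term_def using assms by (intro mult_left_mono powr_mono2) auto
  finally show ?thesis .
qed

lemma ex_profile:
  assumes "1 \<le> \<gamma>" "\<gamma> \<le> n"
  shows "\<exists>Q. \<forall>s. (Q has_real_derivative profile_term (\<gamma> - 1) (1 - n) (Q s)) (at s)"
  using ex_inverse_of_expanding[of "profile_term (- (\<gamma> - 1)) (n - 1)"]
    profile_term_DERIV[THEN DERIV_isCont] profile_term_ge_1[of "\<gamma> - 1" "n - 1"] assms
  by (simp add: profile_term_inverse)

section \<open>The inner function and its gradient\<close>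

text \<open>This is \<phi>. Writing the sum of squares over \<open>i \<noteq> e\<close> as
  \<open>x \<bullet> x - (x $ e)\<^sup>2\<close> keeps its differentiation free of sums.\<close>

definition tilted_paraboloid :: "'n::finite \<Rightarrow> real^'n \<Rightarrow> real"
  where "tilted_paraboloid e x = (x \<bullet> x - (x $ e)\<^sup>2) / 2 - x $ e"

definition tilted_paraboloid_grad :: "'n::finite \<Rightarrow> real^'n \<Rightarrow> real^'n"
  where "tilted_paraboloid_grad e x = x - (x $ e + 1) *\<^sub>R axis e 1"

lemma tilted_paraboloid_grad_nth:
  "tilted_paraboloid_grad e x $ i = (if i = e then - 1 else x $ i)"
  by (simp add: tilted_paraboloid_grad_def axis_def)

lemma tilted_paraboloid_has_derivative:
  "(tilted_paraboloid e has_derivative (\<lambda>h. tilted_paraboloid_grad e x \<bullet> h)) (at x)"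
proof -
  have "(tilted_paraboloid e has_derivative (\<lambda>h. (x \<bullet> h + h \<bullet> x - 2 * x $ e * h $ e) / 2 - h $ e)) (at x)"
    unfolding tilted_paraboloid_def
    by (auto intro!: derivative_eq_intros bounded_linear_imp_has_derivative bounded_linear_vec_nth)
  moreover have "(x \<bullet> h + h \<bullet> x - 2 * x $ e * h $ e) / 2 - h $ e = tilted_paraboloid_grad e x \<bullet> h" for h
    using inner_commute[of h x]
    by (simp add: tilted_paraboloid_grad_def inner_diff_left inner_axis' field_simps)
       (simp add: inner_add_left inner_axis' algebra_simps)
  ultimately show ?thesis
    by simp
qed

lemma continuous_on_tilted_paraboloid_grad: "continuous_on A (tilted_paraboloid_grad e)"
  unfolding tilted_paraboloid_grad_def by (intro continuous_intros)

section \<open>Derivatives of the composed function\<close>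

text \<open>As \<open>profile_term 0 1 q = 1 + exp q\<close>, the second assumption says
  \<open>G' = P\<close> with \<open>P = 1 + exp Q\<close>.\<close>

locale warped_profile =
  fixes e :: "'n::finite" and \<gamma> :: real and Q G :: "real \<Rightarrow> real"
  assumes Q: "\<And>s. (Q has_real_derivative profile_term (\<gamma> - 1) (1 - real CARD('n)) (Q s)) (at s)"
    and G: "\<And>s. (G has_real_derivative profile_term 0 1 (Q s)) (at s)"
begin

abbreviation \<phi> :: "real^'n \<Rightarrow> real" where "\<phi> \<equiv> tilted_paraboloid e"
abbreviation grad :: "real^'n \<Rightarrow> real^'n" where "grad \<equiv> tilted_paraboloid_grad e"

definition term_of :: "real \<Rightarrow> real \<Rightarrow> real^'n \<Rightarrow> real"
  where "term_of c d x = profile_term c d (Q (\<phi> x))"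

definition u :: "real^'n \<Rightarrow> real"
  where "u x = G (\<phi> x)"

lemma profile_DERIV:
  "((\<lambda>s. profile_term c d (Q s)) has_real_derivative
     c * profile_term (c + \<gamma> - 1) (d + 1 - CARD('n)) (Q s) +
     d * profile_term (c + \<gamma>) (d - CARD('n)) (Q s)) (at s)"
proof -
  have "((\<lambda>s. profile_term c d (Q s)) has_real_derivative
     (c * profile_term c d (Q s) + d * profile_term (c + 1) (d - 1) (Q s)) *
       profile_term (\<gamma> - 1) (1 - real CARD('n)) (Q s)) (at s)"
    by (rule DERIV_chain2[OF profile_term_DERIV Q])
  then show ?thesis
    by (simp add: distrib_right mult.assoc profile_term_mult) (simp add: algebra_simps)
qed

lemma term_of_has_derivative:
  "(term_of c d has_derivative (\<lambda>h. (c * term_of (c + \<gamma> - 1) (d + 1 - CARD('n)) x +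
     d * term_of (c + \<gamma>) (d - CARD('n)) x) * (grad x \<bullet> h))) (at x)"
  unfolding term_of_def
  by (rule has_derivative_compose[OF tilted_paraboloid_has_derivative
        profile_DERIV[unfolded has_field_derivative_def]])

lemma u_has_derivative: "(u has_derivative (\<lambda>h. term_of 0 1 x * (grad x \<bullet> h))) (at x)"
  unfolding u_def term_of_def
  by (rule has_derivative_compose[OF tilted_paraboloid_has_derivative
        G[unfolded has_field_derivative_def]])

lemma partial_term_of:
  "partial_deriv i (term_of c d) = (\<lambda>x. (c * term_of (c + \<gamma> - 1) (d + 1 - CARD('n)) x +
     d * term_of (c + \<gamma>) (d - CARD('n)) x) * grad x $ i)"
  by (rule ext, subst partial_deriv_eqI[OF term_of_has_derivative]) (simp add: inner_axis)

lemma partial_u: "partial_deriv i u = (\<lambda>x. term_of 0 1 x * grad x $ i)"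
  by (rule ext, subst partial_deriv_eqI[OF u_has_derivative]) (simp add: inner_axis)

lemma grad_nth_has_derivative:
  "((\<lambda>x. grad x $ j) has_derivative (\<lambda>h. if j = e then 0 else h $ j)) (at x)"
proof (cases "j = e")
  case False
  have "((\<lambda>x::real^'n. x $ j) has_derivative (\<lambda>h. h $ j)) (at x)"
    by (rule bounded_linear.has_derivative[OF bounded_linear_vec_nth has_derivative_ident])
  with False show ?thesis
    by (simp add: tilted_paraboloid_grad_nth)
qed (simp add: tilted_paraboloid_grad_nth)

text \<open>The first derivatives of \<open>u\<close> (with \<open>b = 1\<close>) and of
  \<open>w\<close> (with \<open>b = 1 - \<gamma>\<close>) both have the form differentiated here, so
  this yields both Hessians as bordered matrices.\<close>

lemma partial_term_of_grad:
  "partial_deriv i (\<lambda>x. b * term_of c d x * grad x $ j) x =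
    (if i = j \<and> i \<noteq> e then b * term_of c d x else 0) +
    b * (c * term_of (c + \<gamma> - 1) (d + 1 - CARD('n)) x + d * term_of (c + \<gamma>) (d - CARD('n)) x) *
      grad x $ i * grad x $ j"
proof -
  have "axis i (1::real) $ j = (if i = j then 1 else 0)"
    by (simp add: axis_def)
  moreover have "grad x \<bullet> axis i 1 = grad x $ i"
    by (simp add: inner_axis)
  ultimately show ?thesis
    using partial_deriv_eqI[OF has_derivative_mult[OF has_derivative_mult_right[OF term_of_has_derivative, of b]
        grad_nth_has_derivative], of i] by auto
qed

section \<open>Smoothness\<close>

text \<open>A class closed under partial derivatives, whence every member is \<open>C_k_on k\<close>
  for all \<open>k\<close> by induction. The generator \<open>u\<close> is listed separately because
  \<open>G\<close> is an antiderivative of a profile term.\<close>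

inductive smooth_class :: "(real^'n \<Rightarrow> real) \<Rightarrow> bool" where
  u: "smooth_class u"
| term_of: "smooth_class (term_of c d)"
| const: "smooth_class (\<lambda>_. a)"
| grad: "smooth_class (\<lambda>x. grad x $ i)"
| add: "smooth_class f \<Longrightarrow> smooth_class g \<Longrightarrow> smooth_class (\<lambda>x. f x + g x)"
| mult: "smooth_class f \<Longrightarrow> smooth_class g \<Longrightarrow> smooth_class (\<lambda>x. f x * g x)"

lemma smooth_class_derivative:
  assumes "smooth_class f"
  shows "\<exists>f'. (\<forall>x. (f has_derivative f' x) (at x)) \<and> (\<forall>i. smooth_class (\<lambda>x. f' x (axis i 1)))"
  using assms
proof induction
  case u
  have "smooth_class (\<lambda>x. term_of 0 1 x * grad x $ i)" for i
    by (rule smooth_class.mult[OF smooth_class.term_of smooth_class.grad])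
  then show ?case
    by (intro exI[of _ "\<lambda>x h. term_of 0 1 x * (grad x \<bullet> h)"] conjI allI u_has_derivative)
       (simp add: inner_axis)
next
  case (term_of c d)
  have "smooth_class (\<lambda>x. (c * term_of (c + \<gamma> - 1) (d + 1 - CARD('n)) x +
     d * term_of (c + \<gamma>) (d - CARD('n)) x) * grad x $ i)" for i
    by (rule smooth_class.mult[OF smooth_class.add[OF
          smooth_class.mult[OF smooth_class.const smooth_class.term_of]
          smooth_class.mult[OF smooth_class.const smooth_class.term_of]] smooth_class.grad])
  then show ?case
    by (intro exI[of _ "\<lambda>x h. (c * term_of (c + \<gamma> - 1) (d + 1 - CARD('n)) x +
          d * term_of (c + \<gamma>) (d - CARD('n)) x) * (grad x \<bullet> h)"] conjI allI term_of_has_derivative)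
       (simp add: inner_axis)
next
  case (const a)
  show ?case
    by (rule exI[of _ "\<lambda>_ _. 0"]) (simp add: smooth_class.const)
next
  case (grad j)
  have "smooth_class (\<lambda>x. if j = e then 0 else axis i 1 $ j)" for i
    by (rule smooth_class.const)
  then show ?case
    by (intro exI[of _ "\<lambda>_ h. if j = e then 0 else h $ j"] conjI allI grad_nth_has_derivative)
next
  case (add f g)
  then obtain f' g' where f': "\<And>x. (f has_derivative f' x) (at x)" "\<And>i. smooth_class (\<lambda>x. f' x (axis i 1))"
    and g': "\<And>x. (g has_derivative g' x) (at x)" "\<And>i. smooth_class (\<lambda>x. g' x (axis i 1))"
    by blast
  show ?case
    by (intro exI[of _ "\<lambda>x h. f' x h + g' x h"] conjI allI has_derivative_add
        smooth_class.add[OF f'(2) g'(2)] f'(1) g'(1))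
next
  case (mult f g)
  then obtain f' g' where f': "\<And>x. (f has_derivative f' x) (at x)" "\<And>i. smooth_class (\<lambda>x. f' x (axis i 1))"
    and g': "\<And>x. (g has_derivative g' x) (at x)" "\<And>i. smooth_class (\<lambda>x. g' x (axis i 1))"
    by blast
  show ?case
    by (intro exI[of _ "\<lambda>x h. f x * g' x h + f' x h * g x"] conjI allI has_derivative_mult f'(1) g'(1)
        smooth_class.add[OF smooth_class.mult[OF mult.hyps(1) g'(2)] smooth_class.mult[OF f'(2) mult.hyps(2)]])
qed

lemma smooth_class_C_k_on: "smooth_class f \<Longrightarrow> C_k_on k f A"
proof (induction k arbitrary: f)
  case 0
  then obtain f' where "\<And>x. (f has_derivative f' x) (at x)"
    using smooth_class_derivative by blast
  then have "continuous_on A f"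
    by (intro continuous_at_imp_continuous_on ballI has_derivative_continuous)
  then show ?case
    by simp
next
  case (Suc k)
  then obtain f' where f': "\<And>x. (f has_derivative f' x) (at x)" "\<And>i. smooth_class (\<lambda>x. f' x (axis i 1))"
    using smooth_class_derivative by blast
  have "partial_deriv i f = (\<lambda>x. f' x (axis i 1))" for i
    using partial_deriv_eqI[OF f'(1)] by blast
  moreover have "f differentiable_on A"
    using f'(1) unfolding differentiable_on_def differentiable_def
    by (blast intro: has_derivative_at_withinI)
  ultimately show ?case
    using Suc.IH[OF f'(2)] by simp
qed

section \<open>Convexity and the affine maximal type equation\<close>

lemma hessian_u: "hessian u x = bordered_matrix e (grad x) (term_of 0 1 x) (term_of \<gamma> (1 - real CARD('n)) x)"
  using partial_term_of_grad[where b = 1]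
  by (auto simp: hessian_def bordered_matrix_def partial_u vec_eq_iff)

lemma term_of_pos: "term_of c d x > 0"
  by (simp add: term_of_def profile_term_pos)

lemma grad_e: "grad x $ e = - 1"
  by (simp add: tilted_paraboloid_grad_nth)

lemma pos_def_hessian_u: "pos_def (hessian u x)"
  by (simp add: hessian_u pos_def_bordered_matrix grad_e term_of_pos)

text \<open>With \<open>p = P\<close> and \<open>s = P'\<close>, the factor
  \<open>P ^ (CARD('n) - 1)\<close> cancels the power of \<open>P\<close> in \<open>s\<close>,
  leaving \<open>exp (\<gamma> * Q)\<close>.\<close>

lemma det_hessian_u: "det (hessian u x) = term_of \<gamma> 0 x"
proof -
  have "real (CARD('n) - 1) = real CARD('n) - 1"
    by (simp add: of_nat_diff)
  then show ?thesis
    by (simp add: hessian_u det_bordered_matrix grad_e term_of_def profile_term_power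
        profile_term_mult del: of_nat_diff)
qed

text \<open>The hypothesis gives \<open>\<gamma> * \<theta> = \<gamma> - 1\<close>, so
  \<open>w\<close> is again a profile term. In the trace formula \<open>p' / p\<close> and
  \<open>s' / s\<close> are then \<open>1 - \<gamma>\<close> and
  \<open>(1 - \<gamma>) * (1 - ?n)\<close> times the same function, and the weight
  \<open>?n - 1\<close> on the former makes them cancel.\<close>

lemma affine_maximal_u:
  assumes "\<gamma> * (1 - \<theta>) = 1"
  shows "affine_maximal_type_equation \<theta> A u"
proof -
  have "(\<lambda>x. det (hessian u x) powr - \<theta>) = term_of (1 - \<gamma>) 0"
  proof
    fix x
    have "profile_term \<gamma> 0 q powr - \<theta> = profile_term (1 - \<gamma>) 0 q" for q
    proof -
      have "\<gamma> * \<theta> = \<gamma> - 1"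
        using assms by (simp add: algebra_simps)
      then have "- \<theta> * (\<gamma> * q) = (1 - \<gamma>) * q"
        by algebra
      moreover have "profile_term c 0 q = exp (c * q)" for c
        using add_pos_pos[of 1 "exp q"] by (auto simp: profile_term_def)
      ultimately show ?thesis
        by (simp only: powr_def ln_exp) simp
    qed
    then show "det (hessian u x) powr - \<theta> = term_of (1 - \<gamma>) 0 x"
      by (simp add: det_hessian_u term_of_def)
  qed
  moreover have "(\<Sum>i\<in>UNIV. \<Sum>j\<in>UNIV. matrix_inv (hessian u x) $ i $ j *
      partial_deriv i (partial_deriv j (term_of (1 - \<gamma>) 0)) x) = 0" for x
  proof -
    let ?n = "real CARD('n)"
    define W where "W = bordered_matrix e (grad x) ((1 - \<gamma>) * term_of 0 (1 - ?n) x)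
      ((1 - \<gamma>) * (1 - ?n) * term_of \<gamma> (1 - 2 * ?n) x)"
    have "partial_deriv i (partial_deriv j (term_of (1 - \<gamma>) 0)) x = W $ i $ j" for i j
      using partial_term_of_grad[of i "1 - \<gamma>" 0 "1 - ?n" j x]
      by (simp add: partial_term_of W_def bordered_matrix_def)
    then have "(\<Sum>i\<in>UNIV. \<Sum>j\<in>UNIV. matrix_inv (hessian u x) $ i $ j *
        partial_deriv i (partial_deriv j (term_of (1 - \<gamma>) 0)) x)
      = (?n - 1) * ((1 - \<gamma>) * term_of 0 (1 - ?n) x / term_of 0 1 x)
        + (1 - \<gamma>) * (1 - ?n) * term_of \<gamma> (1 - 2 * ?n) x / term_of \<gamma> (1 - ?n) x"
      unfolding W_def hessian_u
      by (simp add: sum_inverse_bordered_matrix grad_e term_of_pos)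
    also have "\<dots> = 0"
    proof -
      have "term_of 0 (1 - ?n) x / term_of 0 1 x = term_of 0 (- ?n) x"
        "term_of \<gamma> (1 - 2 * ?n) x / term_of \<gamma> (1 - ?n) x = term_of 0 (- ?n) x"
        by (simp_all add: divide_inverse term_of_def profile_term_inverse profile_term_mult)
      then show ?thesis
        by (simp only: times_divide_eq_right[symmetric]) (simp add: algebra_simps)
    qed
    finally show ?thesis .
  qed
  ultimately show ?thesis
    by (simp add: affine_maximal_type_equation_def Let_def)
qed

section \<open>Completeness and non-quadraticity of the solution\<close>

lemma Euclidean_complete_u: "Euclidean_complete (graph_on UNIV u)"
proof (rule Euclidean_complete_entire_graph)
  show "(u has_derivative (\<lambda>h. (term_of 0 1 x *\<^sub>R grad x) \<bullet> h)) (at x)" for x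
    using u_has_derivative by simp
  have "continuous_on UNIV (term_of 0 1)"
    using term_of_has_derivative has_derivative_continuous
    by (intro continuous_at_imp_continuous_on) blast
  then show "continuous_on UNIV (\<lambda>x. term_of 0 1 x *\<^sub>R grad x)"
    by (intro continuous_intros continuous_on_tilted_paraboloid_grad)
qed

text \<open>Along the \<open>e\<close>-axis a quadratic polynomial has affine derivative, whereas
  \<open>G'\<close> is bounded below and not constant.\<close>

lemma not_elliptic_paraboloid_u: "\<not> elliptic_paraboloid (graph_on UNIV u)"
proof
  assume "elliptic_paraboloid (graph_on UNIV u)"
  then obtain A b c where "graph_on UNIV u = graph_on UNIV (\<lambda>x. x \<bullet> (A *v x) + b \<bullet> x + c)"
    unfolding elliptic_paraboloid_def Let_def by blast
  then have u: "u x = x \<bullet> (A *v x) + b \<bullet> x + c" for x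
    by (auto simp: graph_on_def set_eq_iff)
  define \<alpha> \<beta> where "\<alpha> = axis e 1 \<bullet> (A *v axis e 1)" and "\<beta> = - (b \<bullet> axis e 1)"
  have G_eq: "G = (\<lambda>s. \<alpha> * s\<^sup>2 + \<beta> * s + c)"
  proof
    fix s
    \<comment> \<open>On the \<open>e\<close>-axis \<phi> reduces to minus the coordinate, so
      restricting \<open>u\<close> to this axis recovers \<open>G\<close>.\<close>
    have "\<phi> (- s *\<^sub>R axis e 1) = s"
      by (simp add: tilted_paraboloid_def inner_axis_axis power2_eq_square)
    then have "G s = u (- s *\<^sub>R axis e 1)"
      by (simp add: u_def)
    also have "\<dots> = \<alpha> * s\<^sup>2 + \<beta> * s + c"
      unfolding u \<alpha>_def \<beta>_def
      by (simp add: matrix_vector_mult_scaleR power2_eq_square mult.commute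
          del: scaleR_minus_left flip: scaleR_minus_left)
    finally show "G s = \<alpha> * s\<^sup>2 + \<beta> * s + c" .
  qed
  have dG: "(G has_real_derivative 2 * \<alpha> * s + \<beta>) (at s)" for s
    unfolding G_eq by (auto intro!: derivative_eq_intros)
  have G': "2 * \<alpha> * s + \<beta> = 1 + exp (Q s)" for s
    using DERIV_unique[OF G dG, of s] add_pos_pos[of 1 "exp (Q s)"] by (simp add: profile_term_def)
  \<comment> \<open>An affine function with nonzero slope has a zero, whereas
    \<open>1 + exp (Q s)\<close> is positive. Thus \<open>Q\<close> would be constant, against
    \<open>Q' > 0\<close>.\<close>
  have "\<alpha> = 0"
  proof (rule ccontr)
    assume "\<alpha> \<noteq> 0"
    then have "2 * \<alpha> * (- \<beta> / (2 * \<alpha>)) + \<beta> = 0"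
      by simp
    then show False
      using G'[of "- \<beta> / (2 * \<alpha>)"] exp_gt_zero[of "Q (- \<beta> / (2 * \<alpha>))"] by linarith
  qed
  then have "exp (Q s) = exp (Q 0)" for s
    using G'[of s] G'[of 0] by simp
  then have "Q s = Q 0" for s
    by simp
  then have "(Q has_real_derivative 0) (at 0)"
    by (subst ext[of Q "\<lambda>_. Q 0"]) (assumption, rule DERIV_const)
  then show False
    using DERIV_unique[OF Q] profile_term_pos[of "\<gamma> - 1" "1 - real CARD('n)" "Q 0"] by force
qed

end

theorem theoremC:
  fixes \<theta> :: real
  assumes "CARD('n::finite) \<ge> 2"
    and "0 < \<theta>"
    and "\<theta> \<le> (real CARD('n) - 1) / real CARD('n)"
  shows "\<exists>M :: ((real^'n) \<times> real) set.
    affine_maximal_type_hypersurface \<theta> M \<and> Euclidean_complete M \<and> \<not> elliptic_paraboloid M"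
proof -
  define \<gamma> where "\<gamma> = 1 / (1 - \<theta>)"
  \<comment> \<open>The upper bound on \<theta> in this form gives both
    \<open>1 - \<theta> > 0\<close> and, after inversion,
    \<open>\<gamma> \<le> real CARD('n)\<close>.\<close>
  have "1 / real CARD('n) \<le> 1 - \<theta>"
    using assms by (simp add: field_simps)
  moreover have "1 / real CARD('n) > 0"
    by simp
  ultimately have \<theta>: "1 - \<theta> > 0" "1 \<le> real CARD('n) * (1 - \<theta>)"
    by (linarith, simp add: field_simps)
  have \<gamma>: "1 \<le> \<gamma>" "\<gamma> \<le> real CARD('n)" "\<gamma> * (1 - \<theta>) = 1"
    using assms(2) \<theta> by (auto simp: \<gamma>_def field_simps)
  obtain Q where Q: "\<And>s. (Q has_real_derivative profile_term (\<gamma> - 1) (1 - real CARD('n)) (Q s)) (at s)"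
    using ex_profile[OF \<gamma>(1,2)] by blast
  have "isCont (\<lambda>s. profile_term 0 1 (Q s)) s" for s
    by (rule DERIV_isCont[OF DERIV_chain2[OF profile_term_DERIV Q]])
  then obtain G where G: "\<And>s. (G has_real_derivative profile_term 0 1 (Q s)) (at s)"
    using ex_antiderivative by blast
  \<comment> \<open>Any coordinate can play the role of \<open>e\<close>; \<open>undefined\<close>
    merely picks one.\<close>
  interpret warped_profile "undefined :: 'n" \<gamma> Q G
    by unfold_locales (rule Q G)+
  have "affine_maximal_type_hypersurface \<theta> (graph_on UNIV u)"
    unfolding affine_maximal_type_hypersurface_def
    using smooth_class_C_k_on[OF smooth_class.u] pos_def_hessian_u affine_maximal_u[OF \<gamma>(3)]
    by (intro exI[of _ UNIV] exI[of _ u]) (simp add: connected_UNIV)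
  with Euclidean_complete_u not_elliptic_paraboloid_u show ?thesis
    by blast
qed

end
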